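(* Let $\sigma_0$ be a circular arc in the plane of radius $1$ and of arc length less than $1.32$, and let $\sigma_1$ be obtained from $\sigma_0$ by rotating it about one of its endpoints (by any angle). Then for every $\varepsilon>0$ there is a continuous motion $(g_t)_{t\in[0,1]}$ with $g_0=\mathrm{id}$ and $g_1(\sigma_0)=\sigma_1$ such that the Lebesgue measure of $\bigcup_{t\in[0,1]} g_t(\sigma_0)$ is less than $\varepsilon$.
   Context: A continuous motion is a continuous map $t\mapsto g_t$ from $[0,1]$ into the group of orientation-preserving isometries of $\mathbb{R}^2$ (with its natural topology). *)

theory Defs
  imports "HOL-Analysis.Analysis"
begin

text \<open>The plane is modelled as the complex numbers. An orientation-preserving isometry
  of the plane is a map z \<mapsto> a * z + b with norm a = 1; the natural topology on this group
  is that of pairs (a, b), so a continuous motion is given by continuous a, b on [0,1].\<close>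

definition rigid_map :: "complex \<Rightarrow> complex \<Rightarrow> complex \<Rightarrow> complex" where
  "rigid_map a b = (\<lambda>z. a * z + b)"

definition continuous_motion :: "(real \<Rightarrow> complex) \<Rightarrow> (real \<Rightarrow> complex) \<Rightarrow> bool" where
  "continuous_motion a b \<longleftrightarrow>
     continuous_on {0..1} a \<and> continuous_on {0..1} b \<and> (\<forall>t\<in>{0..1}. norm (a t) = 1)"

definition unit_arc :: "complex \<Rightarrow> real \<Rightarrow> real \<Rightarrow> complex set" where
  "unit_arc c \<alpha> L = (\<lambda>\<theta>. c + cis \<theta>) ` {\<alpha>..\<alpha> + L}"

definition rotation_about :: "complex \<Rightarrow> real \<Rightarrow> complex \<Rightarrow> complex" where
  "rotation_about p \<phi> = (\<lambda>z. p + cis \<phi> * (z - p))"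

end

theory Submission
  imports Defs
begin

text \<open>Rotating an arc about its own centre sweeps only a circle, so a position of the arc is
  determined, up to a free move, by its centre, and only translations of the centre cost area.
  Suppose that every translation by \<open>v\<close> can be achieved within area arbitrarily close to
  \<open>\<kappa> |v|\<close>; a plain translation gives this for \<open>\<kappa> = L\<close>. Choose the arc whose tangent directions are
  those of \<open>v\<close> rotated by the angles in \<open>[0, L]\<close>, and replace the translation by many small zigzags:
  a main move in a slightly rotated direction followed by a correction. Iterate on the main moves, on
  much finer scales, until their direction has turned by \<open>L\<close>. Every point of the arc has a tangent
  that is nearly parallel to the main moves of some stage, and finer stages do not leave a small
  neighbourhood of these, so the main moves together sweep an area tending to \<open>0\<close>. The corrections
  are all parallel and lead from \<open>v\<close> to its projection on the ray at angle \<open>L\<close>, hence their total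
  length is \<open>|v| sin L\<close>. So \<open>\<kappa>\<close> improves to \<open>\<kappa> sin L\<close>, and repeating this makes it arbitrarily
  small as \<open>L < \<pi>/2\<close>.\<close>

section \<open>Lebesgue measure on \<open>complex\<close> and on \<open>real^2\<close>\<close>

definition complex_of_vec :: "real^2 \<Rightarrow> complex" where
  "complex_of_vec p = Complex (p $ 1) (p $ 2)"

definition vec_of_complex :: "complex \<Rightarrow> real^2" where
  "vec_of_complex z = (\<chi> i. if i = 1 then Re z else Im z)"

lemma complex_of_vec_of_complex [simp]: "complex_of_vec (vec_of_complex z) = z"
  by (simp add: complex_of_vec_def vec_of_complex_def)

lemma vec_of_complex_of_vec [simp]: "vec_of_complex (complex_of_vec p) = p"
  by (auto simp: complex_of_vec_def vec_of_complex_def vec_eq_iff forall_2)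

lemma linear_vec_of_complex: "linear vec_of_complex"
  by (intro linearI) (auto simp: vec_of_complex_def vec_eq_iff)

lemma continuous_on_complex_of_vec: "continuous_on A complex_of_vec"
  unfolding complex_of_vec_def by (intro continuous_intros)

text \<open>Lebesgue measure is determined by its values on boxes, and the preimage of a box is a
  box with the same side lengths.\<close>

lemma distr_complex_of_vec: "distr lborel borel complex_of_vec = lborel"
proof (rule sym, rule lborel_eqI)
  have meas: "complex_of_vec \<in> borel_measurable borel"
    by (intro borel_measurable_continuous_onI continuous_on_complex_of_vec)
  fix l u :: complex
  assume le: "\<And>b. b \<in> Basis \<Longrightarrow> l \<bullet> b \<le> u \<bullet> b"
  have R: "Re l \<le> Re u" and I: "Im l \<le> Im u"
    using le[of 1] le[of \<i>] by (auto simp: Basis_complex_def)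
  have pre: "complex_of_vec -` box l u = box (vec_of_complex l) (vec_of_complex u)"
    by (auto simp: complex_of_vec_def vec_of_complex_def in_box_complex_iff mem_box_cart forall_2)
  have "emeasure (distr lborel borel complex_of_vec) (box l u) =
        emeasure lborel (box (vec_of_complex l) (vec_of_complex u))"
    using meas by (subst emeasure_distr) (auto simp: pre)
  also have "\<dots> = ennreal (\<Prod>b\<in>Basis. (vec_of_complex u - vec_of_complex l) \<bullet> b)"
    using R I by (intro emeasure_lborel_box)
      (auto simp: Basis_vec_def inner_axis vec_of_complex_def)
  also have "(\<Prod>b\<in>Basis. (vec_of_complex u - vec_of_complex l) \<bullet> b) = (Re u - Re l) * (Im u - Im l)"
  proof -
    have B: "Basis = {axis 1 1, axis 2 1 :: real^2}"
      by (auto simp: Basis_vec_def UNIV_2)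
    show ?thesis
      unfolding B by (simp add: axis_eq_axis inner_axis vec_of_complex_def)
  qed
  also have "\<dots> = (\<Prod>b\<in>Basis. (u - l) \<bullet> b)"
    by (simp add: Basis_complex_def)
  finally show "emeasure (distr lborel borel complex_of_vec) (box l u) = (\<Prod>b\<in>Basis. (u - l) \<bullet> b)" .
qed simp

text \<open>Carries areas over to \<open>real^2\<close>, where the Jacobian estimate
  \<open>measure_bounded_differentiable_image\<close> applies.\<close>

lemma measure_vec_of_complex_image:
  assumes "S \<in> sets borel"
  shows "measure lebesgue (vec_of_complex ` S) = measure lebesgue S"
proof -
  have meas: "complex_of_vec \<in> borel_measurable borel"
    by (intro borel_measurable_continuous_onI continuous_on_complex_of_vec)
  have eq: "vec_of_complex ` S = complex_of_vec -` S"
    by (auto simp: image_iff) (metis vec_of_complex_of_vec)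
  have "measure lborel S = measure (distr lborel borel complex_of_vec) S"
    by (simp add: distr_complex_of_vec)
  also have "\<dots> = measure lborel (complex_of_vec -` S)"
    using assms meas by (subst measure_distr) auto
  finally have "measure lborel S = measure lborel (complex_of_vec -` S)" .
  moreover have "complex_of_vec -` S \<in> sets borel"
    using measurable_sets[OF meas assms] by simp
  ultimately show ?thesis
    using assms by (simp add: eq measure_completion)
qed

section \<open>Area swept by a translated arc\<close>

text \<open>The parametrisation has partial derivatives \<open>w\<close> and
  \<open>\<i> * cis s\<close>, so its Jacobian is \<open>w \<bullet> cis s\<close>, the component of
  \<open>w\<close> normal to the arc. It is small where the arc is nearly tangent to
  \<open>w\<close>.\<close>

lemma measure_segment_plus_arc:
  assumes "s0 \<le> s1" and J: "\<And>s. s \<in> {s0..s1} \<Longrightarrow> \<bar>w \<bullet> cis s\<bar> \<le> J"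
  shows "compact ((\<lambda>(t, s). x + t *\<^sub>R w + cis s) ` ({0..1} \<times> {s0..s1}))" (is "compact ?S")
    and "measure lebesgue ((\<lambda>(t, s). x + t *\<^sub>R w + cis s) ` ({0..1} \<times> {s0..s1})) \<le> J * (s1 - s0)"
proof -
  show comp: "compact ?S"
    unfolding case_prod_beta
    by (intro compact_continuous_image compact_Times compact_Icc continuous_intros)
  define D :: "(real^2) set" where "D = cbox (vector [0, s0]) (vector [1, s1])"
  define F where "F p = vec_of_complex (x + (p $ 1) *\<^sub>R w + cis (p $ 2))" for p :: "real^2"
  define F' where "F' p q = vec_of_complex ((q $ 1) *\<^sub>R w + (q $ 2) *\<^sub>R (\<i> * cis (p $ 2)))"
    for p q :: "real^2"
  have memD: "p \<in> D \<longleftrightarrow> p $ 1 \<in> {0..1} \<and> p $ 2 \<in> {s0..s1}" for p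
    by (auto simp: D_def mem_box_cart forall_2)
  have D: "D \<in> lmeasurable" by (simp add: D_def)
  have mD: "measure lebesgue D = s1 - s0"
  proof -
    have "D \<noteq> {}" using memD[of "vector [0, s0]"] assms(1) by auto
    then show ?thesis
      unfolding D_def by (simp add: content_cbox_cart UNIV_2)
  qed
  have bl: "bounded_linear vec_of_complex"
    using linear_vec_of_complex linear_conv_bounded_linear by blast
  have der: "(F has_derivative F' p) (at p within D)" for p
  proof -
    have nth: "((\<lambda>p. p $ i) has_derivative (\<lambda>q. q $ i)) (at p within D)" for i
      by (rule bounded_linear.has_derivative [OF bounded_linear_vec_nth has_derivative_ident])
    have "(cis has_vector_derivative \<i> * cis (p $ 2)) (at (p $ 2))"
    proof -
      have "((\<lambda>t. Complex (cos t) (sin t)) has_vector_derivative Complex (- sin (p $ 2)) (cos (p $ 2))) (at (p $ 2))"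
        by (auto simp: has_vector_derivative_complex_iff intro!: derivative_eq_intros)
      moreover have "cis = (\<lambda>t. Complex (cos t) (sin t))"
        by (auto simp: complex_eq_iff)
      moreover have "Complex (- sin (p $ 2)) (cos (p $ 2)) = \<i> * cis (p $ 2)"
        by (auto simp: complex_eq_iff)
      ultimately show ?thesis by simp
    qed
    then have c: "((\<lambda>p. cis (p $ 2)) has_derivative (\<lambda>q. (q $ 2) *\<^sub>R (\<i> * cis (p $ 2)))) (at p within D)"
      unfolding has_vector_derivative_def
      using has_derivative_compose[OF nth[of 2]] by blast
    show ?thesis
      unfolding F_def F'_def
      by (rule bounded_linear.has_derivative[OF bl])
         (auto intro!: derivative_eq_intros nth c)
  qed
  have detb: "\<bar>det (matrix (F' p))\<bar> \<le> J" if "p \<in> D" for p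
  proof -
    have "det (matrix (F' p)) = w \<bullet> cis (p $ 2)"
      by (simp add: det_2 matrix_def F'_def vec_of_complex_def axis_def inner_complex_def algebra_simps)
    then show ?thesis using J that memD by auto
  qed
  have FD: "F ` D = vec_of_complex ` ?S"
  proof -
    have "\<exists>p\<in>D. vec_of_complex (x + t *\<^sub>R w + cis s) = F p" if "t \<in> {0..1}" "s \<in> {s0..s1}" for t s
      using that by (intro bexI[of _ "vector [t, s]"]) (auto simp: F_def memD)
    moreover have "F p \<in> vec_of_complex ` ?S" if "p \<in> D" for p
      using that unfolding memD F_def by (intro imageI image_eqI[of _ _ "(p $ 1, p $ 2)"]) auto
    ultimately show ?thesis
      by (fastforce simp: image_iff)
  qed
  have contdet: "(\<lambda>p. \<bar>det (matrix (F' p))\<bar>) integrable_on D"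
    unfolding D_def
    by (intro integrable_continuous)
       (auto simp: det_2 matrix_def F'_def vec_of_complex_def axis_def intro!: continuous_intros)
  have "measure lebesgue (F ` D) \<le> J * measure lebesgue D"
    by (rule measure_bounded_differentiable_image[OF D der contdet detb]) 
  then show "measure lebesgue ?S \<le> J * (s1 - s0)"
    using comp by (simp add: FD mD measure_vec_of_complex_image borel_compact)
qed

text \<open>The centre may stray from the segment by \<open>\<delta>\<close>, which leaves room for
  finer zigzags around it.\<close>

definition arc_tube :: "complex \<Rightarrow> complex \<Rightarrow> real \<Rightarrow> real \<Rightarrow> real \<Rightarrow> complex set" where
  "arc_tube x y \<delta> s0 s1 =
     {z + cis s |z s. s \<in> {s0..s1} \<and> (\<exists>u\<in>closed_segment x y. dist z u \<le> \<delta>)}"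

text \<open>For \<open>\<delta> = 0\<close> the tube is the compact set of the previous estimate.
  Outer regularity puts it into an open \<open>T\<close> of hardly larger measure, and by
  compactness \<open>T\<close> contains a neighbourhood of it of some positive radius.\<close>

lemma measure_arc_tube_limit:
  assumes "s0 \<le> s1" and J: "\<And>s. s \<in> {s0..s1} \<Longrightarrow> \<bar>(y - x) \<bullet> cis s\<bar> \<le> J" and "\<epsilon> > 0"
  obtains \<delta> T where "\<delta> > 0" "T \<in> lmeasurable" "measure lebesgue T \<le> J * (s1 - s0) + \<epsilon>"
    "arc_tube x y \<delta> s0 s1 \<subseteq> T"
proof -
  define S where "S = (\<lambda>(t, s). x + t *\<^sub>R (y - x) + cis s) ` ({0..1} \<times> {s0..s1})"
  have comp: "compact S" and mS: "measure lebesgue S \<le> J * (s1 - s0)"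
    using measure_segment_plus_arc[OF assms(1) J, where x=x] unfolding S_def by auto
  then have SL: "S \<in> lmeasurable" by (simp add: lmeasurable_compact)
  obtain T where T: "open T" "S \<subseteq> T" "T - S \<in> lmeasurable" "emeasure lebesgue (T - S) < ennreal \<epsilon>"
    using sets_lebesgue_outer_open[of S \<epsilon>] SL \<open>\<epsilon> > 0\<close> by (auto simp: fmeasurableD)
  have Teq: "T = S \<union> (T - S)" using T by auto
  then have TL: "T \<in> lmeasurable"
    by (metis SL T(3) fmeasurable.Un)
  have "measure lebesgue T \<le> measure lebesgue S + measure lebesgue (T - S)"
    using measure_Un_le[of S lebesgue "T - S"] SL T(3) Teq by (metis fmeasurableD)
  moreover have "measure lebesgue (T - S) \<le> \<epsilon>"
    using T(3,4) \<open>\<epsilon> > 0\<close> by (simp add: emeasure_eq_measure2 ennreal_less_iff)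
  ultimately have mT: "measure lebesgue T \<le> J * (s1 - s0) + \<epsilon>" using mS by linarith
  obtain \<delta> where \<delta>: "\<delta> > 0" "(\<Union>x\<in>S. cball x \<delta>) \<subseteq> T"
    using compact_subset_open_imp_cball_epsilon_subset[OF comp T(1,2)] by blast
  show ?thesis
  proof (rule that[OF \<delta>(1) TL mT])
    have "z + cis s \<in> T" if u: "u \<in> closed_segment x y" "dist z u \<le> \<delta>" "s \<in> {s0..s1}" for z u s
    proof -
      from u(1) obtain t where "t \<in> {0..1}" "u = x + t *\<^sub>R (y - x)"
        by (auto simp: in_segment algebra_simps)
      then have "u + cis s \<in> S" using u unfolding S_def by (intro image_eqI[of _ _ "(t, s)"]) auto
      moreover have "z + cis s \<in> cball (u + cis s) \<delta>" using u by (simp add: dist_commute)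
      ultimately show "z + cis s \<in> T" using \<delta> by blast
    qed
    then show "arc_tube x y \<delta> s0 s1 \<subseteq> T"
      unfolding arc_tube_def by blast
  qed
qed

lemma measure_Un_bound:
  assumes "A \<in> lmeasurable" "measure lebesgue A \<le> a" "B \<in> lmeasurable" "measure lebesgue B \<le> b"
  shows "A \<union> B \<in> lmeasurable" "measure lebesgue (A \<union> B) \<le> a + b"
  using measure_Un_le[of A lebesgue B] assms by (auto dest: fmeasurableD)

lemma arc_tube_mono:
  assumes "\<delta> \<le> \<delta>'" "s0' \<le> s0" "s1 \<le> s1'"
  shows "arc_tube x y \<delta> s0 s1 \<subseteq> arc_tube x y \<delta>' s0' s1'"
proof
  fix p assume "p \<in> arc_tube x y \<delta> s0 s1"
  then obtain z s u where "p = z + cis s" "s \<in> {s0..s1}" "u \<in> closed_segment x y" "dist z u \<le> \<delta>"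
    unfolding arc_tube_def by blast
  moreover from this have "s \<in> {s0'..s1'}" "dist z u \<le> \<delta>'" using assms by auto
  ultimately show "p \<in> arc_tube x y \<delta>' s0' s1'" unfolding arc_tube_def by blast
qed

lemma arc_tube_split:
  "arc_tube x y \<delta> s0 s2 \<subseteq> arc_tube x y \<delta> s0 s1 \<union> arc_tube x y \<delta> s1 s2"
  unfolding arc_tube_def by fastforce

text \<open>A short move starting on the segment stays within \<open>r\<close> of its starting
  point, so it only widens the tube by \<open>r\<close>.\<close>

lemma arc_tube_near_segment:
  assumes "a \<in> closed_segment x y" and "dist a b \<le> r"
  shows "arc_tube a b \<delta> s0 s1 \<subseteq> arc_tube x y (\<delta> + r) s0 s1"
proof -
  have "dist z a \<le> \<delta> + r" if "u \<in> closed_segment a b" "dist z u \<le> \<delta>" for z u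
  proof -
    have "dist u a \<le> r"
      using segment_bound1[OF that(1)] assms(2) by (simp add: dist_norm norm_minus_commute)
    then show ?thesis using that(2) dist_triangle[of z a u] by linarith
  qed
  then show ?thesis using assms(1) unfolding arc_tube_def by blast
qed

section \<open>Motions as paths of centre and angle\<close>

text \<open>The pair \<open>(x, \<alpha>)\<close> stands for the arc \<open>unit_arc x \<alpha> L\<close>.\<close>

definition sweeps :: "real \<Rightarrow> complex \<times> real \<Rightarrow> complex \<times> real \<Rightarrow> complex set \<Rightarrow> bool" where
  "sweeps L p q S \<longleftrightarrow>
     (\<exists>g. path g \<and> pathstart g = p \<and> pathfinish g = q \<and>
          (\<forall>(x, \<alpha>) \<in> path_image g. unit_arc x \<alpha> L \<subseteq> S))"

lemma sweeps_mono: "sweeps L p q S \<Longrightarrow> S \<subseteq> T \<Longrightarrow> sweeps L p q T"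
  unfolding sweeps_def by fast

lemma sweeps_trans:
  assumes "sweeps L p q S" and "sweeps L q r T"
  shows "sweeps L p r (S \<union> T)"
proof -
  obtain g where g: "path g" "pathstart g = p" "pathfinish g = q"
      "\<forall>(x, \<alpha>) \<in> path_image g. unit_arc x \<alpha> L \<subseteq> S"
    using assms(1) unfolding sweeps_def by blast
  obtain h where h: "path h" "pathstart h = q" "pathfinish h = r"
      "\<forall>(x, \<alpha>) \<in> path_image h. unit_arc x \<alpha> L \<subseteq> T"
    using assms(2) unfolding sweeps_def by blast
  have "path_image (g +++ h) = path_image g \<union> path_image h"
    by (rule path_image_join) (simp add: g h)
  then have "\<forall>(x, \<alpha>) \<in> path_image (g +++ h). unit_arc x \<alpha> L \<subseteq> S \<union> T"
    using g(4) h(4) by fastforce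
  then show ?thesis
    unfolding sweeps_def using g h by (intro exI[of _ "g +++ h"]) simp
qed

lemma sweeps_rotate: "sweeps L (x, \<alpha>) (x, \<beta>) (sphere x 1)"
  unfolding sweeps_def
proof (intro exI conjI)
  show "path (linepath (x, \<alpha>) (x, \<beta>))" by simp
  show "\<forall>(y, \<gamma>) \<in> path_image (linepath (x, \<alpha>) (x, \<beta>)). unit_arc y \<gamma> L \<subseteq> sphere x 1"
    by (auto simp: in_segment unit_arc_def dist_norm algebra_simps simp flip: scaleR_add_left)
qed auto

lemma sweeps_translate: "sweeps L (x, \<alpha>) (y, \<alpha>) (arc_tube x y 0 \<alpha> (\<alpha> + L))"
  unfolding sweeps_def
proof (intro exI conjI)
  show "path (linepath (x, \<alpha>) (y, \<alpha>))" by simp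
  have "z \<in> closed_segment x y \<and> \<gamma> = \<alpha>" if "(z, \<gamma>) \<in> closed_segment (x, \<alpha>) (y, \<alpha>)" for z \<gamma>
    using that by (auto simp: in_segment algebra_simps)
  then show "\<forall>(z, \<gamma>) \<in> path_image (linepath (x, \<alpha>) (y, \<alpha>)).
      unit_arc z \<gamma> L \<subseteq> arc_tube x y 0 \<alpha> (\<alpha> + L)"
    by (fastforce simp: unit_arc_def arc_tube_def)
qed auto

text \<open>Circles are null sets, so turning the arc about its centre before and after the move is
  free.\<close>

lemma sweeps_rotate_ends:
  assumes "sweeps L (x, \<alpha>) (y, \<alpha>) S" "S \<in> lmeasurable" "measure lebesgue S \<le> r"
  shows "\<exists>S\<in>lmeasurable. measure lebesgue S \<le> r \<and> sweeps L (x, \<beta>) (y, \<gamma>) S"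
proof -
  have null: "sphere z 1 \<in> lmeasurable" "measure lebesgue (sphere z 1) \<le> 0" for z :: complex
    using negligible_sphere[of z 1] negligible_imp_measurable negligible_imp_measure0
    by (blast, metis order.refl)
  let ?S = "sphere x 1 \<union> S \<union> sphere y 1"
  have "sweeps L (x, \<beta>) (y, \<gamma>) ?S"
    by (rule sweeps_trans[OF sweeps_trans[OF sweeps_rotate assms(1)] sweeps_rotate])
  moreover have "?S \<in> lmeasurable" "measure lebesgue ?S \<le> 0 + r + 0"
    by (rule measure_Un_bound[OF measure_Un_bound[OF null assms(2,3)] null])+
  ultimately show ?thesis by auto
qed

text \<open>The set \<open>S\<close> is shared by all steps and is not counted \<open>n\<close>
  times; only the exceptional sets \<open>G\<close> add up.\<close>

lemma sweeps_iterate: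
  assumes "n > 0"
    and "\<And>i. i < n \<Longrightarrow> \<exists>G\<in>lmeasurable. measure lebesgue G \<le> b \<and> sweeps L (p i) (p (Suc i)) (S \<union> G)"
  shows "\<exists>G\<in>lmeasurable. measure lebesgue G \<le> real n * b \<and> sweeps L (p 0) (p n) (S \<union> G)"
  using assms
proof (induction n rule: nat_induct_non_zero)
  case 1
  then show ?case by simp
next
  case (Suc n)
  obtain G where G: "G \<in> lmeasurable" "measure lebesgue G \<le> real n * b" "sweeps L (p 0) (p n) (S \<union> G)"
    using Suc.IH Suc.prems by (meson less_Suc_eq)
  obtain H where H: "H \<in> lmeasurable" "measure lebesgue H \<le> b" "sweeps L (p n) (p (Suc n)) (S \<union> H)"
    using Suc.prems by blast
  have "measure lebesgue (G \<union> H) \<le> real (Suc n) * b"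
    using measure_Un_bound(2)[OF G(1,2) H(1,2)] by (simp add: algebra_simps)
  moreover have "sweeps L (p 0) (p (Suc n)) (S \<union> (G \<union> H))"
    by (rule sweeps_mono[OF sweeps_trans[OF G(3) H(3)]]) blast
  moreover have "G \<union> H \<in> lmeasurable" using G(1) H(1) by (rule fmeasurable.Un)
  ultimately show ?case by (intro bexI[of _ "G \<union> H"] conjI)
qed

section \<open>Area per unit of displacement\<close>

definition moving_cost :: "real \<Rightarrow> real \<Rightarrow> bool" where
  "moving_cost L \<kappa> \<longleftrightarrow>
     (\<forall>x y \<alpha> \<beta>. \<forall>\<epsilon>>0. \<exists>S\<in>lmeasurable.
        measure lebesgue S \<le> \<kappa> * dist x y + \<epsilon> \<and> sweeps L (x, \<alpha>) (y, \<beta>) S)"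

lemma moving_costE:
  assumes "moving_cost L \<kappa>" and "\<epsilon> > 0"
  obtains S where "S \<in> lmeasurable" "measure lebesgue S \<le> \<kappa> * dist x y + \<epsilon>"
    "sweeps L (x, \<alpha>) (y, \<beta>) S"
proof -
  have "\<exists>S\<in>lmeasurable. measure lebesgue S \<le> \<kappa> * dist x y + \<epsilon> \<and> sweeps L (x, \<alpha>) (y, \<beta>) S"
    using assms by (simp add: moving_cost_def)
  then show ?thesis by (elim bexE conjE) (rule that)
qed

text \<open>In a plain translation the Jacobian is at most \<open>dist x y\<close>, over an angular
  range of width \<open>L\<close>.\<close>

lemma moving_cost_trivial:
  assumes "0 \<le> L"
  shows "moving_cost L L"
  unfolding moving_cost_def
proof (intro allI impI)
  fix x y :: complex and \<alpha> \<beta> \<epsilon> :: real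
  assume "\<epsilon> > 0"
  have "\<bar>(y - x) \<bullet> cis s\<bar> \<le> dist x y" for s
    using Cauchy_Schwarz_ineq2[of "y - x" "cis s"] by (simp add: dist_norm norm_minus_commute)
  then obtain \<delta> T where T: "\<delta> > 0" "T \<in> lmeasurable"
      "measure lebesgue T \<le> dist x y * (\<alpha> + L - \<alpha>) + \<epsilon>" "arc_tube x y \<delta> \<alpha> (\<alpha> + L) \<subseteq> T"
    using measure_arc_tube_limit[of \<alpha> "\<alpha> + L" y x "dist x y" \<epsilon>] assms \<open>\<epsilon> > 0\<close> by auto
  have "sweeps L (x, \<alpha>) (y, \<alpha>) T"
    using sweeps_mono[OF sweeps_translate] T(1,4) arc_tube_mono[of 0 \<delta> \<alpha> \<alpha> "\<alpha> + L" "\<alpha> + L"]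
    by (metis dual_order.refl dual_order.trans less_eq_real_def)
  moreover have "measure lebesgue T \<le> L * dist x y + \<epsilon>"
    using T(3) by (simp add: mult.commute)
  ultimately show "\<exists>S\<in>lmeasurable. measure lebesgue S \<le> L * dist x y + \<epsilon> \<and> sweeps L (x, \<alpha>) (y, \<beta>) S"
    using T(2) by (intro sweeps_rotate_ends)
qed

section \<open>Geometry of the legs\<close>

text \<open>As \<open>\<tau>\<close> runs from \<open>0\<close> to \<open>L\<close>, \<open>leg L \<tau>\<close> runs along the straight line from \<open>1\<close> to the foot of
  its perpendicular on the ray with direction \<open>cis L\<close>; its own direction is \<open>cis \<tau>\<close>.\<close>

definition leg :: "real \<Rightarrow> real \<Rightarrow> complex" where
  "leg L \<tau> = complex_of_real (cos L / cos (L - \<tau>)) * cis \<tau>"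

text \<open>In coordinates turned by \<open>L\<close>, every leg has real part \<open>cos L\<close>
  and only the imaginary part varies. Hence all differences of legs are parallel.\<close>

lemma leg_eq:
  assumes "0 < L" "L < pi / 2" "0 \<le> \<tau>" "\<tau> \<le> L"
  shows "leg L \<tau> = cis L * complex_of_real (cos L) * (1 - \<i> * complex_of_real (tan (L - \<tau>)))"
proof -
  have "cos (L - \<tau>) > 0" using assms by (intro cos_gt_zero_pi) auto
  then have "complex_of_real (inverse (cos (L - \<tau>))) * cis (\<tau> - L) = 1 - \<i> * complex_of_real (tan (L - \<tau>))"
    using sin_minus[of "L - \<tau>"] cos_minus[of "L - \<tau>"]
    by (auto simp: complex_eq_iff tan_def field_simps)
  moreover have "cis \<tau> = cis L * cis (\<tau> - L)" by (simp add: cis_mult)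
  ultimately show ?thesis
    by (simp add: leg_def divide_inverse mult_ac)
qed

text \<open>As a difference of values of one function of the angle, the length telescopes over
  successive stages.\<close>

lemma norm_leg_diff:
  assumes "0 < L" "L < pi / 2" "0 \<le> \<tau>" "\<tau> \<le> \<tau>'" "\<tau>' \<le> L"
  shows "norm (leg L \<tau> - leg L \<tau>') = cos L * (tan (L - \<tau>) - tan (L - \<tau>'))"
proof -
  have "leg L \<tau> - leg L \<tau>' =
      cis L * complex_of_real (cos L) * (\<i> * complex_of_real (tan (L - \<tau>') - tan (L - \<tau>)))"
    using assms by (simp add: leg_eq algebra_simps)
  moreover have "tan (L - \<tau>') \<le> tan (L - \<tau>)"
    using assms by (intro tan_mono_le) auto
  moreover have "cos L > 0" using assms by (intro cos_gt_zero_pi) auto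
  ultimately show ?thesis by (simp add: norm_mult del: of_real_diff)
qed

text \<open>At angle \<open>\<psi> + pi / 2 + \<sigma>\<close> the tangent of the arc is parallel to
  \<open>cis (\<psi> + \<sigma>)\<close>. The turned leg has direction
  \<open>cis (\<psi> + \<tau>)\<close> and length at most \<open>1\<close>, so its normal component
  is at most \<open>sin (\<sigma> - \<tau>)\<close> in absolute value.\<close>

lemma leg_inner_normal:
  assumes "0 < L" "L < pi / 2" "0 \<le> \<tau>" "\<tau> \<le> \<sigma>" "\<sigma> \<le> L"
  shows "\<bar>(cis \<psi> * leg L \<tau>) \<bullet> cis (\<psi> + pi / 2 + \<sigma>)\<bar> \<le> \<sigma> - \<tau>"
proof -
  have c: "0 < cos L" "cos L \<le> cos (L - \<tau>)"
    using assms by (auto intro!: cos_gt_zero_pi cos_monotone_0_pi_le)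
  have "cis \<psi> * leg L \<tau> = (cos L / cos (L - \<tau>)) *\<^sub>R cis (\<psi> + \<tau>)"
    by (simp add: leg_def scaleR_conv_of_real flip: cis_mult)
  moreover have "cis a \<bullet> cis b = cos (b - a)" for a b
    by (simp add: inner_complex_def cos_diff)
  ultimately have "(cis \<psi> * leg L \<tau>) \<bullet> cis (\<psi> + pi / 2 + \<sigma>) =
      cos L / cos (L - \<tau>) * cos (\<psi> + pi / 2 + \<sigma> - (\<psi> + \<tau>))"
    by (simp only: inner_scaleR_left)
  also have "cos (\<psi> + pi / 2 + \<sigma> - (\<psi> + \<tau>)) = - sin (\<sigma> - \<tau>)"
    using minus_sin_cos_eq[of "\<sigma> - \<tau>"] by (simp add: algebra_simps)
  finally have "\<bar>(cis \<psi> * leg L \<tau>) \<bullet> cis (\<psi> + pi / 2 + \<sigma>)\<bar> = cos L / cos (L - \<tau>) * \<bar>sin (\<sigma> - \<tau>)\<bar>"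
    using c by (simp add: abs_mult)
  also have "\<dots> \<le> 1 * \<bar>\<sigma> - \<tau>\<bar>"
    using c by (intro mult_mono abs_sin_x_le_abs_x) (auto simp: field_simps)
  finally show ?thesis using assms by simp
qed

section \<open>The nested zigzag construction\<close>

text \<open>Stage \<open>k\<close> moves the centre along \<open>m k\<close>. It is realised by many short zigzags, each
  consisting of a stage \<open>k + 1\<close> move along a small multiple of \<open>m (k + 1)\<close> followed by a
  correction parallel to \<open>m k - m (k + 1)\<close>. All later main moves stay close to the segment of stage
  \<open>k\<close>, hence the part of the arc whose tangents are nearly parallel to \<open>m k\<close> sweeps little more
  than it does in a plain translation along that segment. The remaining part, with smaller angles,
  is left in the tube, to be accounted for at the earlier stages.\<close>

lemma zigzag_stage:
  fixes \<rho> \<psi> \<kappa> L :: real and N k :: nat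
  assumes L: "0 < L" "L < pi / 2" and cost: "moving_cost L \<kappa>" and "\<rho> \<ge> 0" and "N > 0" and "k \<le> N"
  defines "h \<equiv> L / real N" and "\<alpha> \<equiv> \<psi> + pi / 2"
  defines "m \<equiv> \<lambda>k. complex_of_real \<rho> * cis \<psi> * leg L (real k * h)"
    and "c \<equiv> \<lambda>k. (real N - real k) * \<rho> * h\<^sup>2 + \<kappa> * \<rho> * (cos L * tan (L - real k * h))"
  assumes "\<nu> \<ge> 0" "\<delta> > 0" "\<epsilon> > 0"
  shows "\<exists>G\<in>lmeasurable. measure lebesgue G \<le> \<nu> * c k + \<epsilon> \<and>
      sweeps L (x, \<alpha>) (x + \<nu> *\<^sub>R m k, \<alpha>) (arc_tube x (x + \<nu> *\<^sub>R m k) \<delta> \<alpha> (\<alpha> + real k * h) \<union> G)"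
  using \<open>k \<le> N\<close> \<open>\<nu> \<ge> 0\<close> \<open>\<delta> > 0\<close> \<open>\<epsilon> > 0\<close>
\<comment> \<open>In \<open>c k\<close>, each stage from \<open>k\<close> to \<open>N - 1\<close> is
  charged \<open>\<rho> * h\<^sup>2\<close> for its own sector of angles, and the last term is
  \<open>\<kappa>\<close> times the distance from \<open>m k\<close> to \<open>m N\<close>. The
  induction descends from \<open>N\<close>; the start, scale and tolerances are generalised because
  stage \<open>k\<close> uses many small moves of stage \<open>k + 1\<close>.\<close>
proof (induction k arbitrary: x \<nu> \<delta> \<epsilon> rule: inc_induct)
  case base
  \<comment> \<open>At stage \<open>N\<close> the tube already carries all angles of the arc, so a
    plain translation fits into it at no extra cost.\<close>
  have "arc_tube x y 0 \<alpha> (\<alpha> + L) \<subseteq> arc_tube x y \<delta> \<alpha> (\<alpha> + real N * h)" for y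
    using base \<open>N > 0\<close> by (intro arc_tube_mono) (auto simp: h_def)
  then have "sweeps L (x, \<alpha>) (x + \<nu> *\<^sub>R m N, \<alpha>) (arc_tube x (x + \<nu> *\<^sub>R m N) \<delta> \<alpha> (\<alpha> + real N * h) \<union> {})"
    using sweeps_mono[OF sweeps_translate] by auto
  moreover have "c N = 0" using \<open>N > 0\<close> by (simp add: c_def h_def)
  ultimately show ?case using base by (intro bexI[of _ "{}"]) auto
next
  case (step k)
  define y where "y = x + \<nu> *\<^sub>R m k"
  have h: "h > 0" using L \<open>N > 0\<close> by (simp add: h_def)
  have kh: "real (Suc k) * h \<le> L"
  proof -
    have "real (Suc k) * h \<le> real N * h" using step.hyps h by (intro mult_right_mono) auto
    then show ?thesis using \<open>N > 0\<close> by (simp add: h_def)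
  qed
  \<comment> \<open>On this sector the tangents deviate from \<open>m k\<close> by at most
    \<open>h\<close>. Jacobian bound times width gives the charge
    \<open>\<nu> * \<rho> * h\<^sup>2\<close>.\<close>
  have inner: "\<bar>(y - x) \<bullet> cis s\<bar> \<le> \<nu> * \<rho> * h" if "s \<in> {\<alpha> + real k * h..\<alpha> + real (Suc k) * h}" for s
  proof -
    have "\<bar>(cis \<psi> * leg L (real k * h)) \<bullet> cis (\<psi> + pi / 2 + (s - \<alpha>))\<bar> \<le> (s - \<alpha>) - real k * h"
      using that kh h L by (intro leg_inner_normal) auto
    also have "\<dots> \<le> h" using that by (auto simp: algebra_simps)
    finally have *: "\<bar>(cis \<psi> * leg L (real k * h)) \<bullet> cis s\<bar> \<le> h" by (simp add: \<alpha>_def)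
    have "y - x = (\<nu> * \<rho>) *\<^sub>R (cis \<psi> * leg L (real k * h))"
      by (simp add: y_def m_def scaleR_conv_of_real)
    then have "\<bar>(y - x) \<bullet> cis s\<bar> = (\<nu> * \<rho>) * \<bar>(cis \<psi> * leg L (real k * h)) \<bullet> cis s\<bar>"
      using step.prems \<open>\<rho> \<ge> 0\<close> by (simp add: abs_mult)
    also have "\<dots> \<le> (\<nu> * \<rho>) * h"
      using * step.prems \<open>\<rho> \<ge> 0\<close> by (intro mult_left_mono) auto
    finally show ?thesis by simp
  qed
  obtain \<delta>1 T where T: "\<delta>1 > 0" "T \<in> lmeasurable"
      "measure lebesgue T \<le> \<nu> * \<rho> * h * ((\<alpha> + real (Suc k) * h) - (\<alpha> + real k * h)) + \<epsilon> / 2"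
      "arc_tube x y \<delta>1 (\<alpha> + real k * h) (\<alpha> + real (Suc k) * h) \<subseteq> T"
  proof (rule measure_arc_tube_limit[of "\<alpha> + real k * h" "\<alpha> + real (Suc k) * h" y x "\<nu> * \<rho> * h" "\<epsilon> / 2"])
    show "\<alpha> + real k * h \<le> \<alpha> + real (Suc k) * h" using h by (simp add: algebra_simps)
    show "\<epsilon> / 2 > 0" using step.prems by simp
  qed (use inner that in blast)+
  \<comment> \<open>Below \<open>\<delta>\<close> to respect the required tube, below
    \<open>\<delta>1\<close> to keep the new sector inside \<open>T\<close>.\<close>
  define d where "d = min \<delta> \<delta>1"
  have d: "d > 0" "d \<le> \<delta>" "d \<le> \<delta>1" using T step.prems by (auto simp: d_def)
  \<comment> \<open>With this many zigzags each main move strays at most \<open>d / 2\<close> from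
    the segment, leaving the other \<open>d / 2\<close> to the deeper stages.\<close>
  obtain n :: nat where n: "n > 0" "\<nu> * norm (m (Suc k)) / real n \<le> d / 2"
  proof -
    obtain n :: nat where n: "\<nu> * norm (m (Suc k)) / (d / 2) < real n"
      using reals_Archimedean2 by blast
    moreover have "0 \<le> \<nu> * norm (m (Suc k)) / (d / 2)" using step.prems d by simp
    ultimately have "real n > 0" by linarith
    then show ?thesis using n d that[of n] by (simp add: field_simps)
  qed
  define \<mu> where "\<mu> = \<nu> / real n"
  have \<mu>: "\<mu> \<ge> 0" "real n * \<mu> = \<nu>" using n step.prems by (auto simp: \<mu>_def)
  define p where "p i = (x + (real i * \<mu>) *\<^sub>R m k, \<alpha>)" for i
  \<comment> \<open>The cost of one zigzag: the deeper stages, the correction, and two errors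
    \<open>\<epsilon> / (4 * real n)\<close>.\<close>
  define b where "b = \<mu> * (c (Suc k) + \<kappa> * norm (m k - m (Suc k))) + \<epsilon> / (2 * real n)"
  let ?S = "arc_tube x y d \<alpha> (\<alpha> + real (Suc k) * h)"
  have stepi: "\<exists>G\<in>lmeasurable. measure lebesgue G \<le> b \<and> sweeps L (p i) (p (Suc i)) (?S \<union> G)"
    if i: "i < n" for i
  proof -
    define a where "a = x + (real i * \<mu>) *\<^sub>R m k"
    define a' where "a' = a + \<mu> *\<^sub>R m (Suc k)"
    define a'' where "a'' = x + (real (Suc i) * \<mu>) *\<^sub>R m k"
    have e: "\<epsilon> / (4 * real n) > 0" using step.prems n by simp
    obtain G where G: "G \<in> lmeasurable" "measure lebesgue G \<le> \<mu> * c (Suc k) + \<epsilon> / (4 * real n)"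
        "sweeps L (a, \<alpha>) (a', \<alpha>) (arc_tube a a' (d / 2) \<alpha> (\<alpha> + real (Suc k) * h) \<union> G)"
      using step.IH[OF \<mu>(1) _ e, of "d / 2" a] d unfolding a'_def by auto
    obtain H where H: "H \<in> lmeasurable" "measure lebesgue H \<le> \<kappa> * dist a' a'' + \<epsilon> / (4 * real n)"
        "sweeps L (a', \<alpha>) (a'', \<alpha>) H"
      using moving_costE[OF cost e] .
    have "a \<in> closed_segment x y"
      unfolding in_segment
    proof (intro exI conjI)
      show "0 \<le> real i / real n" "real i / real n \<le> 1" using i by auto
      show "a = (1 - real i / real n) *\<^sub>R x + (real i / real n) *\<^sub>R y"
        by (simp add: a_def y_def \<mu>_def algebra_simps)
    qed
    moreover have "dist a a' \<le> d / 2"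
      using n step.prems(1) by (simp add: a'_def dist_norm \<mu>_def)
    ultimately have "arc_tube a a' (d / 2) \<alpha> (\<alpha> + real (Suc k) * h) \<subseteq> ?S"
      using arc_tube_near_segment[of a x y a' "d / 2" "d / 2"] by simp
    then have "sweeps L (a, \<alpha>) (a'', \<alpha>) (?S \<union> (G \<union> H))"
      by (intro sweeps_mono[OF sweeps_trans[OF G(3) H(3)]]) blast
    moreover have "dist a' a'' = \<mu> * norm (m k - m (Suc k))"
    proof -
      have "a'' - a' = \<mu> *\<^sub>R (m k - m (Suc k))"
        by (simp add: a'_def a''_def a_def algebra_simps)
      then have "dist a'' a' = \<mu> * norm (m k - m (Suc k))" using \<mu> by (simp add: dist_norm)
      then show ?thesis by (simp add: dist_commute)
    qed
    then have "(\<mu> * c (Suc k) + \<epsilon> / (4 * real n)) + (\<kappa> * dist a' a'' + \<epsilon> / (4 * real n)) = b"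
      by (simp add: b_def algebra_simps)
    then have "measure lebesgue (G \<union> H) \<le> b"
      using measure_Un_bound(2)[OF G(1,2) H(1,2)] by linarith
    moreover have "G \<union> H \<in> lmeasurable" using G(1) H(1) by (rule fmeasurable.Un)
    ultimately show ?thesis
      unfolding p_def a_def a''_def by (intro bexI[of _ "G \<union> H"] conjI)
  qed
  obtain G where G: "G \<in> lmeasurable" "measure lebesgue G \<le> real n * b" "sweeps L (p 0) (p n) (?S \<union> G)"
    using sweeps_iterate[where p = p and S = ?S, OF n(1) stepi] by blast
  \<comment> \<open>The top sector is paid for once, by \<open>T\<close>, for all \<open>n\<close>
    zigzags together; the smaller angles stay in the tube.\<close>
  have "?S \<subseteq> arc_tube x y d \<alpha> (\<alpha> + real k * h) \<union> arc_tube x y d (\<alpha> + real k * h) (\<alpha> + real (Suc k) * h)"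
    by (rule arc_tube_split)
  also have "\<dots> \<subseteq> arc_tube x y \<delta> \<alpha> (\<alpha> + real k * h) \<union> T"
    using d by (intro Un_mono arc_tube_mono order.trans[OF arc_tube_mono T(4)]) auto
  finally have "sweeps L (p 0) (p n) (arc_tube x y \<delta> \<alpha> (\<alpha> + real k * h) \<union> (T \<union> G))"
    by (intro sweeps_mono[OF G(3)]) blast
  moreover have "p 0 = (x, \<alpha>)" "p n = (y, \<alpha>)" using \<mu> by (simp_all add: p_def y_def)
  moreover have "measure lebesgue (T \<union> G) \<le> \<nu> * c k + \<epsilon>"
  proof -
    have "m k - m (Suc k) = complex_of_real \<rho> * (cis \<psi> * (leg L (real k * h) - leg L (real (Suc k) * h)))"
      by (simp add: m_def algebra_simps)
    also have "norm \<dots> = \<rho> * norm (leg L (real k * h) - leg L (real (Suc k) * h))"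
      using \<open>\<rho> \<ge> 0\<close> by (simp add: norm_mult)
    also have "norm (leg L (real k * h) - leg L (real (Suc k) * h)) =
        cos L * (tan (L - real k * h) - tan (L - real (Suc k) * h))"
      using L h kh by (intro norm_leg_diff) (auto simp: algebra_simps)
    finally have nm: "norm (m k - m (Suc k)) = \<rho> * (cos L * (tan (L - real k * h) - tan (L - real (Suc k) * h)))" .
    have "real n * b = (real n * \<mu>) * (c (Suc k) + \<kappa> * norm (m k - m (Suc k))) + \<epsilon> / 2"
      using n by (simp add: b_def field_simps)
    \<comment> \<open>The correction length is exactly the decrease of the tangent term from
      \<open>c k\<close> to \<open>c (Suc k)\<close>; what remains of the decrease is
      \<open>\<rho> * h\<^sup>2\<close>, the share of \<open>T\<close>.\<close>
    also have "\<dots> = \<nu> * (c k - \<rho> * h\<^sup>2) + \<epsilon> / 2"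
      unfolding nm \<mu>(2) by (simp add: c_def algebra_simps)
    finally have "measure lebesgue G \<le> \<nu> * (c k - \<rho> * h\<^sup>2) + \<epsilon> / 2" using G(2) by simp
    moreover have "measure lebesgue T \<le> \<nu> * (\<rho> * h\<^sup>2) + \<epsilon> / 2"
      using T(3) by (simp add: algebra_simps power2_eq_square)
    ultimately have "measure lebesgue (T \<union> G) \<le>
        (\<nu> * (\<rho> * h\<^sup>2) + \<epsilon> / 2) + (\<nu> * (c k - \<rho> * h\<^sup>2) + \<epsilon> / 2)"
      using T(2) G(1) by (intro measure_Un_bound(2))
    then show ?thesis by (simp add: algebra_simps)
  qed
  moreover have "T \<union> G \<in> lmeasurable" using T(2) G(1) by (rule fmeasurable.Un)
  ultimately show ?case unfolding y_def[symmetric] by (intro bexI[of _ "T \<union> G"]) auto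
qed

section \<open>Reducing the cost to zero\<close>

text \<open>This is stage \<open>0\<close> of the zigzags, whose main move is the whole displacement
  because \<open>leg L 0 = 1\<close>. The corrections have total length
  \<open>\<rho> * cos L * tan L = \<rho> * sin L\<close>, and the sectors cost
  \<open>\<rho> * L\<^sup>2 / N\<close>, which vanishes for large \<open>N\<close>.\<close>

lemma moving_cost_contracts:
  assumes L: "0 < L" "L < pi / 2" and cost: "moving_cost L \<kappa>"
  shows "moving_cost L (\<kappa> * sin L)"
  unfolding moving_cost_def
proof (intro allI impI)
  fix x y :: complex and \<beta> \<gamma> \<epsilon> :: real
  assume "\<epsilon> > 0"
  define \<rho> where "\<rho> = norm (y - x)"
  define \<psi> where "\<psi> = Arg (y - x)"
  \<comment> \<open>With this angle the arc starts tangent to \<open>y - x\<close>.\<close>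
  define \<alpha> where "\<alpha> = \<psi> + pi / 2"
  have yx: "y - x = complex_of_real \<rho> * cis \<psi>"
    unfolding \<rho>_def \<psi>_def by (metis rcis_cmod_Arg rcis_def)
  have "\<rho> \<ge> 0" by (simp add: \<rho>_def)
  \<comment> \<open>Makes the sector cost \<open>\<rho> * L\<^sup>2 / N\<close> at most
    \<open>\<epsilon> / 3\<close>.\<close>
  obtain N :: nat where N: "3 * \<rho> * L\<^sup>2 / \<epsilon> < real N" using reals_Archimedean2 by blast
  moreover have "3 * \<rho> * L\<^sup>2 / \<epsilon> \<ge> 0" using \<open>\<epsilon> > 0\<close> \<open>\<rho> \<ge> 0\<close> by simp
  ultimately have Np: "N > 0" by (metis gr0I of_nat_0 not_le)
  have cosL: "cos L > 0" using L by (intro cos_gt_zero_pi) auto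
  have "leg L 0 = 1" using cosL by (simp add: leg_def)
  then have m0: "x + 1 *\<^sub>R (complex_of_real \<rho> * cis \<psi> * leg L (real 0 * (L / real N))) = y"
    using yx by (simp add: algebra_simps)
  \<comment> \<open>The tube left over at stage \<open>0\<close> carries the single angle
    \<open>\<alpha>\<close>; its limit has measure zero, so a small \<open>\<delta>\<close> makes it
    cost at most \<open>\<epsilon> / 3\<close>.\<close>
  obtain \<delta> T where T: "\<delta> > 0" "T \<in> lmeasurable" "measure lebesgue T \<le> \<rho> * (\<alpha> - \<alpha>) + \<epsilon> / 3"
      "arc_tube x y \<delta> \<alpha> \<alpha> \<subseteq> T"
  proof (rule measure_arc_tube_limit[of \<alpha> \<alpha> y x \<rho> "\<epsilon> / 3"])
    show "\<bar>(y - x) \<bullet> cis s\<bar> \<le> \<rho>" for s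
      using Cauchy_Schwarz_ineq2[of "y - x" "cis s"] by (simp add: \<rho>_def)
    show "\<epsilon> / 3 > 0" using \<open>\<epsilon> > 0\<close> by simp
  qed simp
  obtain G where G: "G \<in> lmeasurable"
    "measure lebesgue G \<le> 1 * ((real N - real 0) * \<rho> * (L / real N)\<^sup>2 +
       \<kappa> * \<rho> * (cos L * tan (L - real 0 * (L / real N)))) + \<epsilon> / 3"
    "sweeps L (x, \<alpha>) (y, \<alpha>) (arc_tube x y \<delta> \<alpha> (\<alpha> + real 0 * (L / real N)) \<union> G)"
    using zigzag_stage[OF L cost \<open>\<rho> \<ge> 0\<close> Np, where k = 0 and \<nu> = 1 and \<delta> = \<delta> and \<epsilon> = "\<epsilon> / 3" and \<psi> = \<psi> and x = x] T(1) \<open>\<epsilon> > 0\<close>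
    unfolding m0 \<alpha>_def[symmetric] by auto
  have "real N * \<rho> * (L / real N)\<^sup>2 = \<rho> * L\<^sup>2 / real N"
    using Np by (simp add: power2_eq_square)
  also have "\<dots> \<le> \<epsilon> / 3"
    using N Np \<open>\<epsilon> > 0\<close> by (simp add: field_simps)
  finally have "measure lebesgue G \<le> \<kappa> * sin L * dist x y + 2 * \<epsilon> / 3"
    using G(2) cosL by (simp add: tan_def \<rho>_def dist_norm norm_minus_commute algebra_simps)
  then have "measure lebesgue (T \<union> G) \<le> \<kappa> * sin L * dist x y + \<epsilon>"
    using measure_Un_bound(2)[OF T(2,3) G(1)] by fastforce
  moreover have "sweeps L (x, \<alpha>) (y, \<alpha>) (T \<union> G)"
    using T(4) by (intro sweeps_mono[OF G(3)]) auto
  ultimately show "\<exists>S\<in>lmeasurable. measure lebesgue S \<le> \<kappa> * sin L * dist x y + \<epsilon> \<and>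
      sweeps L (x, \<beta>) (y, \<gamma>) S"
    using fmeasurable.Un[OF T(2) G(1)] by (intro sweeps_rotate_ends)
qed

lemma moving_cost_power:
  assumes "0 < L" "L < pi / 2"
  shows "moving_cost L (L * sin L ^ r)"
proof (induction r)
  case 0
  show ?case using moving_cost_trivial[of L] assms by simp
next
  case (Suc r)
  show ?case using moving_cost_contracts[OF assms Suc.IH] by (simp add: mult_ac)
qed

lemma sweeps_arbitrarily_small:
  assumes L: "0 < L" "L < pi / 2" and "\<epsilon> > 0"
  obtains S where "S \<in> lmeasurable" "measure lebesgue S < \<epsilon>" "sweeps L (x, \<alpha>) (y, \<beta>) S"
proof -
  have "0 \<le> sin L" using L by (intro sin_ge_zero) auto
  moreover have "sin L < 1" using sin_monotone_2pi[of L "pi / 2"] L by simp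
  ultimately have "(\<lambda>r. L * sin L ^ r * dist x y) \<longlonglongrightarrow> L * 0 * dist x y"
    by (intro tendsto_intros LIMSEQ_realpow_zero)
  then have "\<forall>\<^sub>F r in sequentially. L * sin L ^ r * dist x y < \<epsilon> / 2"
    using \<open>\<epsilon> > 0\<close> by (intro order_tendstoD(2)) auto
  then obtain r where r: "L * sin L ^ r * dist x y < \<epsilon> / 2"
    by (auto simp: eventually_sequentially)
  have "\<epsilon> / 2 > 0" using \<open>\<epsilon> > 0\<close> by simp
  obtain S where "S \<in> lmeasurable" "measure lebesgue S \<le> L * sin L ^ r * dist x y + \<epsilon> / 2"
      "sweeps L (x, \<alpha>) (y, \<beta>) S"
    using moving_costE[OF moving_cost_power[OF L] \<open>\<epsilon> / 2 > 0\<close>] .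
  then show ?thesis using r that[of S] by auto
qed

section \<open>From paths of arcs to rigid motions\<close>

text \<open>The rotation part shifts all angles by \<open>\<beta> - \<alpha>\<close>; the
  translation part is the one that takes the centre \<open>c\<close> to \<open>x\<close>.\<close>

lemma rigid_map_unit_arc:
  "rigid_map (cis (\<beta> - \<alpha>)) (x - cis (\<beta> - \<alpha>) * c) ` unit_arc c \<alpha> L = unit_arc x \<beta> L"
proof -
  have "rigid_map (cis (\<beta> - \<alpha>)) (x - cis (\<beta> - \<alpha>) * c) ` unit_arc c \<alpha> L =
      (\<lambda>\<theta>. x + cis (\<theta> + (\<beta> - \<alpha>))) ` {\<alpha>..\<alpha> + L}"
    unfolding unit_arc_def rigid_map_def image_image
    by (intro image_cong) (auto simp: algebra_simps cis_mult)
  also have "\<dots> = (\<lambda>\<theta>. x + cis \<theta>) ` ((\<lambda>\<theta>. \<theta> + (\<beta> - \<alpha>)) ` {\<alpha>..\<alpha> + L})"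
    by (simp only: image_image)
  also have "(\<lambda>\<theta>. \<theta> + (\<beta> - \<alpha>)) ` {\<alpha>..\<alpha> + L} = {\<beta>..\<beta> + L}"
    by (simp add: image_add_atLeastAtMost' add.commute)
  finally show ?thesis by (simp add: unit_arc_def)
qed

text \<open>A rigid map is determined by its angle and the image of one point, here the centre of
  the arc.\<close>

lemma rotation_about_eq_rigid_map:
  "rotation_about p \<phi> = rigid_map (cis \<phi>) (rotation_about p \<phi> c - cis \<phi> * c)"
  by (auto simp: rotation_about_def rigid_map_def algebra_simps)

text \<open>Measuring angles from the start of the arc makes the parameter range
  \<open>{0..L}\<close> independent of \<open>t\<close>, so the union is a continuous image of a
  rectangle.\<close>

lemma compact_swept_arcs:
  assumes "continuous_on {0..1} f" "continuous_on {0..1} g"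
  shows "compact (\<Union>t\<in>{0..1::real}. unit_arc (f t) (g t) L)"
proof -
  have "(\<Union>t\<in>{0..1}. unit_arc (f t) (g t) L) =
      (\<lambda>(t, \<sigma>). f t + cis (g t + \<sigma>)) ` ({0..1} \<times> {0..L})"
  proof -
    have "unit_arc (f t) (g t) L = (\<lambda>\<sigma>. f t + cis (g t + \<sigma>)) ` {0..L}" for t
    proof -
      have "{g t..g t + L} = (\<lambda>\<sigma>. g t + \<sigma>) ` {0..L}" by simp
      then show ?thesis by (simp only: unit_arc_def image_image)
    qed
    then show ?thesis by fastforce
  qed
  moreover have "continuous_on ({0..1} \<times> {0..L}) (\<lambda>q. f (fst q) + cis (g (fst q) + snd q))"
    by (intro continuous_intros continuous_on_compose2[OF assms(1)] continuous_on_compose2[OF assms(2)]) auto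
  ultimately show ?thesis
    by (simp add: case_prod_beta compact_continuous_image compact_Times)
qed

theorem theorem2:
  fixes c p :: complex and \<alpha> L \<phi> \<epsilon> :: real
  assumes "0 < L" and "L < 1.32"
    and "p \<in> {c + cis \<alpha>, c + cis (\<alpha> + L)}"
    and "\<epsilon> > 0"
  shows "\<exists>a b. continuous_motion a b \<and> rigid_map (a 0) (b 0) = id \<and>
           rigid_map (a 1) (b 1) ` unit_arc c \<alpha> L = rotation_about p \<phi> ` unit_arc c \<alpha> L \<and>
           (\<Union>t\<in>{0..1}. rigid_map (a t) (b t) ` unit_arc c \<alpha> L) \<in> sets lebesgue \<and>
           emeasure lebesgue (\<Union>t\<in>{0..1}. rigid_map (a t) (b t) ` unit_arc c \<alpha> L) < ennreal \<epsilon>"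
proof -
  \<comment> \<open>From \<open>pi > 3\<close> follows \<open>pi / 2 > 1.5\<close>, which exceeds
    \<open>1.32\<close>.\<close>
  have L: "0 < L" "L < pi / 2" using assms(1,2) pi_gt3 by auto
  \<comment> \<open>The rotated arc is the unit arc with centre \<open>c'\<close> and starting angle
    \<open>\<alpha> + \<phi>\<close>, which is the target of the path.\<close>
  define c' where "c' = rotation_about p \<phi> c"
  obtain S where S: "S \<in> lmeasurable" "measure lebesgue S < \<epsilon>" "sweeps L (c, \<alpha>) (c', \<alpha> + \<phi>) S"
    using sweeps_arbitrarily_small[OF L \<open>\<epsilon> > 0\<close>] by blast
  obtain g where g: "path g" "pathstart g = (c, \<alpha>)" "pathfinish g = (c', \<alpha> + \<phi>)"
      "\<forall>(x, \<beta>) \<in> path_image g. unit_arc x \<beta> L \<subseteq> S"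
    using S(3) unfolding sweeps_def by blast
  define a where "a t = cis (snd (g t) - \<alpha>)" for t
  define b where "b t = fst (g t) - a t * c" for t
  have cont: "continuous_on {0..1} (\<lambda>t. fst (g t))" "continuous_on {0..1} (\<lambda>t. snd (g t))"
    using g(1) unfolding path_def by (auto intro: continuous_intros)
  have arc: "rigid_map (a t) (b t) ` unit_arc c \<alpha> L = unit_arc (fst (g t)) (snd (g t)) L" for t
    unfolding a_def b_def by (rule rigid_map_unit_arc)
  let ?U = "\<Union>t\<in>{0..1}. rigid_map (a t) (b t) ` unit_arc c \<alpha> L"
  have "compact ?U" unfolding arc using cont by (rule compact_swept_arcs)
  then have meas: "?U \<in> sets lebesgue" by (simp add: borel_compact)
  have "?U \<subseteq> S" unfolding arc using g(4) by (fastforce simp: path_image_def)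
  then have "emeasure lebesgue ?U \<le> emeasure lebesgue S"
    using S(1) by (intro emeasure_mono fmeasurableD)
  also have "\<dots> < ennreal \<epsilon>"
    using S(1,2) \<open>\<epsilon> > 0\<close> by (simp add: emeasure_eq_measure2 ennreal_less_iff)
  finally have small: "emeasure lebesgue ?U < ennreal \<epsilon>" .
  have "continuous_motion a b"
    unfolding continuous_motion_def a_def b_def by (auto intro!: continuous_intros cont)
  moreover have "rigid_map (a 0) (b 0) = id"
    using g(2) by (auto simp: a_def b_def rigid_map_def pathstart_def)
  moreover have "rigid_map (a 1) (b 1) = rotation_about p \<phi>"
    using g(3) rotation_about_eq_rigid_map[of p \<phi> c] by (simp add: a_def b_def c'_def pathfinish_def)
  ultimately show ?thesis using meas small by (intro exI[of _ a] exI[of _ b]) auto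
qed

end
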